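(* Let $n\ge 3$, let $\mathcal L$ be a coherent lattice path of size $n+1$ and let $\mathcal L'$ be its restriction (of size $n$). Then $\mathcal L'$ is coherent, and $\mathcal L$ belongs to one of the following 12 mutually exclusive cases, where lists of enhanced steps are ordered lists, "$\mathcal S,\ s_1,\dots,s_t$" means the list $\mathcal S$ followed by the steps $s_1,\dots,s_t$, and $\mathcal S(\cdot)$ denotes the list of enhanced steps: (i) $\mathcal L'$ ends with the step $(x\to n;n-1)$ with $x<n-1$; let $\mathcal S'$ be $\mathcal S(\mathcal L')$ with this last step removed. Then $\mathcal S(\mathcal L)$ is one of: (a) $\mathcal S(\mathcal L'),\ (n-1\to n+1;n)$; (b) $\mathcal S(\mathcal L'),\ (n\to n+1;n-1),\ (n-1\to n;n+1)$; (c) $\mathcal S',\ (x\to n+1;n-1),\ (n-1\to n;n+1)$. (ii) $\mathcal L'$ ends with the steps $(x\to n;y_1),(y_1\to y_2;n),\dots,(y_{m-1}\to y_m;n)$ with $x<n-1$, $m\ge3$, $y_1<\dots<y_m=n-1$; let $\mathcal S'$ be $\mathcal S(\mathcal L')$ with these $m$ final steps removed. Then $\mathcal S(\mathcal L)$ is one of: (a) $\mathcal S(\mathcal L'),\ (n-1\to n+1;n)$; (b) $\mathcal S(\mathcal L')$ with its last step $(y_{m-1}\to n-1;n)$ replaced by $(y_{m-1}\to n+1;n)$; (c) $\mathcal S',\ (x\to n+1;y_1),(y_1\to y_2;n+1),\dots,(y_{m-2}\to y_{m-1};n+1),(y_{m-1}\to n-1;n+1),(n-1\to n;n+1)$; (d)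 $\mathcal S',\ (x\to n+1;y_1),(y_1\to y_2;n+1),\dots,(y_{m-2}\to y_{m-1};n+1),(y_{m-1}\to n;n+1)$. (iii) $\mathcal L'$ ends with the steps $(x\to n;y),(y\to n-1;n)$ with $x<n$, $y<n-1$; let $\mathcal S'$ be $\mathcal S(\mathcal L')$ with these two steps removed. Then $\mathcal S(\mathcal L)$ is one of: (a) $\mathcal S(\mathcal L'),\ (n-1\to n+1;n)$; (b) $\mathcal S(\mathcal L')$ with its last step $(y\to n-1;n)$ replaced by $(y\to n+1;n)$; (c) $\mathcal S(\mathcal L')$ with its last step $(y\to n-1;n)$ removed, followed by $(n\to n+1;y),(y\to n;n+1)$; (d) $\mathcal S',\ (x\to n+1;y),(y\to n-1;n+1),(n-1\to n;n+1)$; (e) $\mathcal S',\ (x\to n+1;y),(y\to n;n+1)$.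
   Context: A diagonal-avoiding lattice path of size $n$ and dimension $2$ is a sequence $(\boldsymbol\ell_1,\dots,\boldsymbol\ell_r)$ of points of $[n]^2$ with $\boldsymbol\ell_1=(2,1)$, $\boldsymbol\ell_r\in\{(n-1,n),(n,n-1)\}$, $\ell_{i,1}\neq\ell_{i,2}$ for all $i$, and for each $i\in[r-1]$ exactly one coordinate $p$ changes, with $\ell_{i,p}<\ell_{i+1,p}$ (the other coordinate $q$ staying fixed). Its $i$-th enhanced step is written $(\ell_{i,p}\to\ell_{i+1,p};\ell_{i,q})$ ("the moving coordinate goes from $\ell_{i,p}$ to $\ell_{i+1,p}$ while the other coordinate equals $\ell_{i,q}$"); steps are ordered by $\prec$ according to their position in the path; the length is $r$. Such a path is a coherent lattice path if for every pair of enhanced steps $(i\to j;a)\prec(x\to y;z)$ with $x<j$ one has $j=z$ or $x=a$. The restriction of a diagonal-avoiding lattice path $\mathcal L=(\boldsymbol\ell_1,\dots,\boldsymbol\ell_r)$ of size $n+1$ (dimension 2) is the diagonal-avoiding lattice path $\mathcal L'$ of size $n$ obtained as follows: (1) replace every coordinate equal to $n+1$ by $n$ in each point, obtaining $\boldsymbol\ell'_1,\dots,\boldsymbol\ell'_r$ (so $\boldsymbol\ell'_r=(n,n)$); (2) if $\boldsymbol\ell'_{r-1}=(x,n)$ set $\boldsymbol\ell'_r=(n-1,n)$, and if $\boldsymbol\ell'_{r-1}=(n,x)$ set $\boldsymbol\ell'_r=(n,n-1)$; (3) whenever two consecutive points coincide, discard the repetition, until no consecutive repeats remain. *)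

theory Defs
  imports Main
begin

text \<open>
  Lattice paths are lists of points; list indices are zero-based, coordinates are one-based.
  Everything is in dimension 2.
\<close>

type_synonym point = "nat \<times> nat"

definition lattice_move :: "point \<Rightarrow> point \<Rightarrow> bool" where
  "lattice_move p q \<longleftrightarrow>
     (fst p < fst q \<and> snd p = snd q) \<or> (fst p = fst q \<and> snd p < snd q)"

definition diagonal_avoiding_path :: "nat \<Rightarrow> point list \<Rightarrow> bool" where
  "diagonal_avoiding_path n L \<longleftrightarrow>
     L \<noteq> [] \<and>
     set L \<subseteq> {1..n} \<times> {1..n} \<and>
     hd L = (2, 1) \<and>
     last L \<in> {(n - 1, n), (n, n - 1)} \<and>
     (\<forall>p \<in> set L. fst p \<noteq> snd p) \<and>
     (\<forall>i. Suc i < length L \<longrightarrow> lattice_move (L ! i) (L ! Suc i))"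

text \<open>
  \<open>\<langle>i \<rightarrow> j; a\<rangle>\<close>: the moving coordinate goes from \<open>i\<close> to \<open>j\<close> while the other one equals \<open>a\<close>.
  Which of the two coordinates moves is not recorded.
\<close>

datatype enhanced_step =
  Step (src: nat) (tgt: nat) (other: nat)  ("\<langle>_ \<rightarrow> _; _\<rangle>")

definition enhanced_step :: "point \<Rightarrow> point \<Rightarrow> enhanced_step" where
  "enhanced_step p q =
     (if fst p \<noteq> fst q then \<langle>fst p \<rightarrow> fst q; snd p\<rangle> else \<langle>snd p \<rightarrow> snd q; fst p\<rangle>)"

definition enhanced_steps :: "point list \<Rightarrow> enhanced_step list" where
  "enhanced_steps L = map2 enhanced_step L (tl L)"

definition coherent_steps :: "enhanced_step list \<Rightarrow> bool" where
  "coherent_steps S \<longleftrightarrow>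
     (\<forall>k l. k < l \<and> l < length S \<and> src (S ! l) < tgt (S ! k) \<longrightarrow>
        tgt (S ! k) = other (S ! l) \<or> src (S ! l) = other (S ! k))"

definition coherent_lattice_path :: "nat \<Rightarrow> point list \<Rightarrow> bool" where
  "coherent_lattice_path n L \<longleftrightarrow>
     diagonal_avoiding_path n L \<and> coherent_steps (enhanced_steps L)"

text \<open>
  \<open>restriction n\<close> takes a path of size \<open>n + 1\<close> to a path of size \<open>n\<close>.  In \<open>adjust_last\<close>, the
  arguments are the last two points after replacing \<open>n + 1\<close> by \<open>n\<close>.  For \<open>n \<ge> 3\<close> the path has
  at least two points and the penultimate one, so replaced, has exactly one coordinate equal to
  \<open>n\<close>, so the order of the tests and the final \<open>else\<close> branch are immaterial.
\<close>

definition replace_coord :: "nat \<Rightarrow> nat \<Rightarrow> nat" where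
  "replace_coord n a = (if a = n + 1 then n else a)"

definition adjust_last :: "nat \<Rightarrow> point \<Rightarrow> point \<Rightarrow> point" where
  "adjust_last n p q =
     (if snd p = n then (n - 1, n) else if fst p = n then (n, n - 1) else q)"

definition restriction :: "nat \<Rightarrow> point list \<Rightarrow> point list" where
  "restriction n L =
     (let M = map (map_prod (replace_coord n) (replace_coord n)) L;
          N = butlast M @ [adjust_last n (last (butlast M)) (last M)]
      in remdups_adj N)"

text \<open>
  In the remaining definitions \<open>R\<close> stands for the enhanced steps of the restriction, \<open>S'\<close> for
  \<open>R\<close> without the final steps singled out in the case, and \<open>S\<close> for the enhanced steps of the
  original path.  Only the values \<open>y 1, \<dots>, y m\<close> of \<open>y\<close> are relevant; note that \<open>[1..<m]\<close> stops
  at \<open>m - 1\<close>.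
\<close>

definition ends_i ::
    "nat \<Rightarrow> enhanced_step list \<Rightarrow> enhanced_step list \<Rightarrow> nat \<Rightarrow> bool" where
  "ends_i n R S' x \<longleftrightarrow>
     R = S' @ [\<langle>x \<rightarrow> n; n - 1\<rangle>] \<and> x < n - 1"

definition ends_ii ::
    "nat \<Rightarrow> enhanced_step list \<Rightarrow> enhanced_step list \<Rightarrow> nat \<Rightarrow> nat \<Rightarrow> (nat \<Rightarrow> nat) \<Rightarrow> bool" where
  "ends_ii n R S' x m y \<longleftrightarrow>
     R = S' @ [\<langle>x \<rightarrow> n; y 1\<rangle>] @ map (\<lambda>i. \<langle>y i \<rightarrow> y (i + 1); n\<rangle>) [1..<m] \<and>
     x < n - 1 \<and> 3 \<le> m \<and> (\<forall>i \<in> {1..<m}. y i < y (i + 1)) \<and> y m = n - 1"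

definition ends_iii ::
    "nat \<Rightarrow> enhanced_step list \<Rightarrow> enhanced_step list \<Rightarrow> nat \<Rightarrow> nat \<Rightarrow> bool" where
  "ends_iii n R S' x y \<longleftrightarrow>
     R = S' @ [\<langle>x \<rightarrow> n; y\<rangle>, \<langle>y \<rightarrow> n - 1; n\<rangle>] \<and> x < n \<and> y < n - 1"

datatype case_label =
    I_a | I_b | I_c
  | II_a | II_b | II_c | II_d
  | III_a | III_b | III_c | III_d | III_e

fun restriction_case ::
    "case_label \<Rightarrow> nat \<Rightarrow> enhanced_step list \<Rightarrow> enhanced_step list \<Rightarrow> bool" where
  "restriction_case I_a n R S \<longleftrightarrow>
     (\<exists>S' x. ends_i n R S' x \<and>
        S = R @ [\<langle>n - 1 \<rightarrow> n + 1; n\<rangle>])"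
| "restriction_case I_b n R S \<longleftrightarrow>
     (\<exists>S' x. ends_i n R S' x \<and>
        S = R @ [\<langle>n \<rightarrow> n + 1; n - 1\<rangle>, \<langle>n - 1 \<rightarrow> n; n + 1\<rangle>])"
| "restriction_case I_c n R S \<longleftrightarrow>
     (\<exists>S' x. ends_i n R S' x \<and>
        S = S' @ [\<langle>x \<rightarrow> n + 1; n - 1\<rangle>, \<langle>n - 1 \<rightarrow> n; n + 1\<rangle>])"
| "restriction_case II_a n R S \<longleftrightarrow>
     (\<exists>S' x m y. ends_ii n R S' x m y \<and>
        S = R @ [\<langle>n - 1 \<rightarrow> n + 1; n\<rangle>])"
| "restriction_case II_b n R S \<longleftrightarrow>
     (\<exists>S' x m y. ends_ii n R S' x m y \<and>
        S = butlast R @ [\<langle>y (m - 1) \<rightarrow> n + 1; n\<rangle>])"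
| "restriction_case II_c n R S \<longleftrightarrow>
     (\<exists>S' x m y. ends_ii n R S' x m y \<and>
        S = S' @ [\<langle>x \<rightarrow> n + 1; y 1\<rangle>]
            @ map (\<lambda>i. \<langle>y i \<rightarrow> y (i + 1); n + 1\<rangle>) [1..<m - 1]
            @ [\<langle>y (m - 1) \<rightarrow> n - 1; n + 1\<rangle>, \<langle>n - 1 \<rightarrow> n; n + 1\<rangle>])"
| "restriction_case II_d n R S \<longleftrightarrow>
     (\<exists>S' x m y. ends_ii n R S' x m y \<and>
        S = S' @ [\<langle>x \<rightarrow> n + 1; y 1\<rangle>]
            @ map (\<lambda>i. \<langle>y i \<rightarrow> y (i + 1); n + 1\<rangle>) [1..<m - 1]
            @ [\<langle>y (m - 1) \<rightarrow> n; n + 1\<rangle>])"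
| "restriction_case III_a n R S \<longleftrightarrow>
     (\<exists>S' x y. ends_iii n R S' x y \<and>
        S = R @ [\<langle>n - 1 \<rightarrow> n + 1; n\<rangle>])"
| "restriction_case III_b n R S \<longleftrightarrow>
     (\<exists>S' x y. ends_iii n R S' x y \<and>
        S = butlast R @ [\<langle>y \<rightarrow> n + 1; n\<rangle>])"
| "restriction_case III_c n R S \<longleftrightarrow>
     (\<exists>S' x y. ends_iii n R S' x y \<and>
        S = butlast R @ [\<langle>n \<rightarrow> n + 1; y\<rangle>, \<langle>y \<rightarrow> n; n + 1\<rangle>])"
| "restriction_case III_d n R S \<longleftrightarrow>
     (\<exists>S' x y. ends_iii n R S' x y \<and>
        S = S' @ [\<langle>x \<rightarrow> n + 1; y\<rangle>, \<langle>y \<rightarrow> n - 1; n + 1\<rangle>, \<langle>n - 1 \<rightarrow> n; n + 1\<rangle>])"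
| "restriction_case III_e n R S \<longleftrightarrow>
     (\<exists>S' x y. ends_iii n R S' x y \<and>
        S = S' @ [\<langle>x \<rightarrow> n + 1; y\<rangle>, \<langle>y \<rightarrow> n; n + 1\<rangle>])"

end

theory Submission
  imports Defs
begin

text \<open>
  Cut the path where a coordinate first becomes at least \<open>n\<close>; by symmetry this happens to the
  first coordinate, by a step \<open>\<langle>x \<rightarrow> c; y\<rangle>\<close>.  Coherence leaves only three possible continuations: the second coordinate
  climbs from \<open>y\<close> to \<open>n\<close> at \<open>c = n + 1\<close>, or it climbs from \<open>y\<close> to \<open>n + 1\<close> at \<open>c = n\<close>, or
  the steps are \<open>\<langle>n \<rightarrow> n + 1; y\<rangle>, \<langle>y \<rightarrow> n; n + 1\<rangle>\<close>.  In each of them the restriction climbs at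
  \<open>n\<close> through the same sources below \<open>n\<close>, up to \<open>n - 1\<close>.  The twelve cases arise from the
  three continuations according to whether \<open>n - 1\<close> is a source and whether the climb of the
  restriction has no step, one step, or more.
\<close>

section \<open>Enhanced steps\<close>

lemma enhanced_steps_simps [simp]:
  "enhanced_steps [] = []"
  "enhanced_steps [p] = []"
  "enhanced_steps (p # q # L) = enhanced_step p q # enhanced_steps (q # L)"
  by (simp_all add: enhanced_steps_def)

lemma enhanced_steps_append:
  assumes "H \<noteq> []" "T \<noteq> []"
  shows "enhanced_steps (H @ T) =
    enhanced_steps H @ enhanced_step (last H) (hd T) # enhanced_steps T"
  using assms(1)
proof (induction H rule: list_nonempty_induct)
  case (single p)
  then show ?case using assms(2) by (cases T) auto
next
  case (cons p H)
  then show ?case by (cases H) auto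
qed

text \<open>\<open>enhanced_step\<close> forgets which coordinate moves. The assumption matters: if
  both coordinates changed, the first one would always be picked, and the exchange could alter the
  step.\<close>

lemma enhanced_step_swap:
  "lattice_move p q \<Longrightarrow> enhanced_step (prod.swap p) (prod.swap q) = enhanced_step p q"
  by (auto simp: lattice_move_def enhanced_step_def)

lemma enhanced_steps_swap:
  "successively lattice_move L \<Longrightarrow> enhanced_steps (map prod.swap L) = enhanced_steps L"
  by (induction L rule: induct_list012) (auto simp: enhanced_step_swap)

section \<open>Runs of steps along which the fixed coordinate is constant\<close>

definition climb :: "nat \<Rightarrow> nat list \<Rightarrow> enhanced_step list" where
  "climb c ys = map2 (\<lambda>a b. \<langle>a \<rightarrow> b; c\<rangle>) ys (tl ys)"

lemma climb_simps [simp]: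
  "climb c [] = []"
  "climb c [a] = []"
  "climb c (a # b # ys) = \<langle>a \<rightarrow> b; c\<rangle> # climb c (b # ys)"
  by (simp_all add: climb_def)

lemma climb_snoc:
  "ys \<noteq> [] \<Longrightarrow> climb c (ys @ [z]) = climb c ys @ [\<langle>last ys \<rightarrow> z; c\<rangle>]"
  by (induction ys rule: induct_list012) auto

text \<open>Translates list positions into the one-based index range used by case (ii).\<close>

lemma climb_conv_nth:
  "climb c ys = map (\<lambda>i. \<langle>ys ! (i - 1) \<rightarrow> ys ! i; c\<rangle>) [1..<length ys]"
  by (rule nth_equalityI) (auto simp: climb_def nth_tl)

lemma enhanced_steps_map_Pair: "enhanced_steps (map (Pair c) ys) = climb c ys"
  by (induction ys rule: induct_list012) (auto simp: enhanced_step_def)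

lemma src_climb: "s \<in> set ys \<Longrightarrow> \<exists>t. \<langle>s \<rightarrow> t; c\<rangle> \<in> set (climb c (ys @ [z]))"
  by (induction ys rule: induct_list012) auto

lemma in_climbD: "s \<in> set (climb c ys) \<Longrightarrow> other s = c \<and> src s \<in> set (butlast ys)"
  by (induction ys rule: induct_list012) auto

section \<open>Coherence\<close>

text \<open>Coherence for a single pair, the earlier step first. As a relation under
  \<open>sorted_wrt\<close> it splits along \<open>@\<close>.\<close>

definition compatible :: "enhanced_step \<Rightarrow> enhanced_step \<Rightarrow> bool" where
  "compatible s t \<longleftrightarrow> (src t < tgt s \<longrightarrow> tgt s = other t \<or> src t = other s)"

lemma coherent_steps_iff: "coherent_steps S \<longleftrightarrow> sorted_wrt compatible S"
  unfolding coherent_steps_def sorted_wrt_iff_nth_less compatible_def by blast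

lemma le_last:
  fixes ys :: "'a::linorder list"
  shows "sorted_wrt (<) ys \<Longrightarrow> a \<in> set ys \<Longrightarrow> a \<le> last ys"
  by (induction ys) (auto intro: less_imp_le)

lemma hd_eq_last_imp_singleton:
  fixes ys :: "'a::linorder list"
  assumes "sorted_wrt (<) ys" "ys \<noteq> []" "hd ys = last ys"
  shows "ys = [hd ys]"
proof (cases ys)
  case (Cons a as)
  have "as = []"
  proof (rule ccontr)
    assume "as \<noteq> []"
    then have "last as \<in> set as" "last as = a" using assms(3) by (simp_all add: Cons)
    then show False using assms(1) by (auto simp: Cons)
  qed
  then show ?thesis by (simp add: Cons)
qed (use assms in simp)

text \<open>Later sources are at least the earlier targets, so the premise
  \<open>src t < tgt s\<close> never holds between an earlier step \<open>s\<close> and a later step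
  \<open>t\<close> of a climb.\<close>

lemma coherent_climb: "sorted_wrt (<) ys \<Longrightarrow> sorted_wrt compatible (climb c ys)"
proof (induction ys rule: induct_list012)
  case (3 a b ys)
  have "b \<le> src s" if "s \<in> set (climb c (b # ys))" for s
  proof -
    have "src s \<in> set (b # ys)"
      using that by (blast dest: in_climbD in_set_butlastD)
    with "3.prems" show ?thesis by auto
  qed
  then have "compatible \<langle>a \<rightarrow> b; c\<rangle> s" if "s \<in> set (climb c (b # ys))" for s
    using that by (simp add: compatible_def leD)
  moreover have "sorted_wrt compatible (climb c (b # ys))"
    using 3 by simp
  ultimately show ?case by simp
qed auto

section \<open>Walks\<close>

text \<open>The start may be either of the two mirror images, so that walks are closed under
  exchanging the coordinates.\<close>

definition walk :: "nat \<Rightarrow> point list \<Rightarrow> bool" where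
  "walk n L \<longleftrightarrow> L \<noteq> [] \<and> set L \<subseteq> {1..n} \<times> {1..n} \<and> (\<forall>p\<in>set L. fst p \<noteq> snd p) \<and>
     successively lattice_move L \<and> hd L \<in> {(2, 1), (1, 2)} \<and> last L \<in> {(n - 1, n), (n, n - 1)}"

lemma diagonal_avoiding_path_iff:
  "diagonal_avoiding_path n L \<longleftrightarrow> walk n L \<and> hd L = (2, 1)"
  unfolding diagonal_avoiding_path_def walk_def successively_conv_nth by auto

lemma lattice_move_swap [simp]:
  "lattice_move (prod.swap p) (prod.swap q) \<longleftrightarrow> lattice_move p q"
  by (auto simp: lattice_move_def)

lemma walk_swap:
  assumes "walk n L"
  shows "walk n (map prod.swap L)"
proof -
  have "successively lattice_move (map prod.swap L)"
    using assms by (simp add: walk_def successively_map)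
  then show ?thesis
    using assms unfolding walk_def by (auto simp: hd_map last_map)
qed

text \<open>A transitive weakening of \<open>lattice_move\<close>, which is not transitive itself: a
  horizontal and a vertical move do not compose to a move.\<close>

definition weakly_below :: "point \<Rightarrow> point \<Rightarrow> bool" where
  "weakly_below p q \<longleftrightarrow> fst p \<le> fst q \<and> snd p \<le> snd q"

lemma sorted_wrt_weakly_below:
  assumes "successively lattice_move L"
  shows "sorted_wrt weakly_below L"
proof -
  have "successively weakly_below L"
    by (rule successively_mono[OF assms]) (auto simp: lattice_move_def weakly_below_def)
  moreover have "transp weakly_below"
    by (auto simp: transp_def weakly_below_def)
  ultimately show ?thesis by (simp add: successively_conv_sorted_wrt)
qed

lemma remdups_adj_walk: "successively lattice_move L \<Longrightarrow> remdups_adj L = L"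
  by (induction L rule: induct_list012) (auto simp: lattice_move_def)

lemma vertical_walk:
  assumes "successively lattice_move T" "\<forall>p\<in>set T. fst p = c"
  obtains ys where "T = map (Pair c) ys" "sorted_wrt (<) ys"
proof -
  have T: "T = map (Pair c) (map snd T)"
    using assms(2) by (induction T) auto
  have "successively (\<lambda>p q. snd p < snd q) T"
    by (rule successively_mono[OF assms(1)]) (use assms(2) in \<open>auto simp: lattice_move_def\<close>)
  then have "successively (<) (map snd T)"
    by (simp add: successively_map)
  then have "sorted_wrt (<) (map snd T)"
    by (simp add: successively_conv_sorted_wrt)
  with T that show thesis by blast
qed

text \<open>The last step either moves the first coordinate, and so ends at its final value, or the
  shorter path already reaches that value.\<close>

lemma ex_step_into:
  assumes "successively lattice_move L" "L \<noteq> []" "fst (hd L) < fst (last L)"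
  shows "\<exists>u w. \<langle>u \<rightarrow> fst (last L); w\<rangle> \<in> set (enhanced_steps L)"
  using assms(2,1,3)
proof (induction L rule: rev_nonempty_induct)
  case (snoc p L)
  have move: "lattice_move (last L) p" and L: "successively lattice_move L"
    using snoc.prems snoc.hyps by (auto simp: successively_append_iff)
  have steps: "enhanced_steps (L @ [p]) = enhanced_steps L @ [enhanced_step (last L) p]"
    using snoc.hyps by (simp add: enhanced_steps_append)
  show ?case
  proof (cases "fst (last L) = fst p")
    case True
    then show ?thesis using snoc.IH L snoc.prems snoc.hyps steps by auto
  next
    case False
    then show ?thesis using steps by (auto simp: enhanced_step_def)
  qed
qed auto

section \<open>Uniqueness of the case\<close>

text \<open>Each case forces its own label, so twelve checks replace a comparison of all pairs of
  cases. The targets of the last two steps of \<open>R\<close> separate (i), (ii) and (iii); the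
  lengths and the last step of \<open>S\<close> separate the subcases.\<close>

definition classify :: "nat \<Rightarrow> enhanced_step list \<Rightarrow> enhanced_step list \<Rightarrow> case_label" where
  "classify n R S =
    (if tgt (last R) = n then
       if length S = length R + 2 then I_b else if tgt (last S) = n then I_c else I_a
     else if tgt (last (butlast R)) = n then
       if length S = length R then (if tgt (last S) = n then III_e else III_b)
       else if tgt (last S) = n + 1 then III_a
       else if src (last S) = n - 1 then III_d else III_c
     else
       if length S = length R then (if tgt (last S) = n then II_d else II_b)
       else if tgt (last S) = n then II_c else II_a)"

text \<open>As \<open>3 \<le> m\<close>, the penultimate step of \<open>R\<close> belongs to the
  climb and ends at \<open>y (m - 1)\<close>, whereas in (iii) it ends at \<open>n\<close>.\<close>

lemma ends_iiD:
  assumes "ends_ii n R S' x m y"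
  shows "tgt (last R) = n - 1 \<and> tgt (last (butlast R)) < n - 1 \<and> length R = length S' + m \<and> 3 \<le> m
    \<and> y (m - 1) < n - 1"
proof -
  from assms have R: "R = S' @ [\<langle>x \<rightarrow> n; y 1\<rangle>] @ map (\<lambda>i. \<langle>y i \<rightarrow> y (i + 1); n\<rangle>) [1..<m]"
    and m: "3 \<le> m" and inc: "\<forall>i\<in>{1..<m}. y i < y (i + 1)" and ym: "y m = n - 1"
    by (auto simp: ends_ii_def)
  \<comment> \<open>In this form the simplifier can split the last two indices off
    \<open>[1..<m]\<close>.\<close>
  from m obtain k where k: "m = Suc (Suc (Suc k))"
    by (metis One_nat_def Suc_le_D numeral_3_eq_3 Suc_le_mono)
  have "y (m - 1) < n - 1"
    using inc[rule_format, of "m - 1"] m ym by simp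
  then show ?thesis
    using ym unfolding R k by (simp add: butlast_append)
qed

text \<open>\<open>classify\<close> does not mention the witnesses \<open>S'\<close>,
  \<open>x\<close>, \<open>m\<close>, \<open>y\<close>, so at most one label can fit given
  \<open>R\<close> and \<open>S\<close>, whatever the witnesses are.\<close>

lemma restriction_case_classify:
  assumes "restriction_case c n R S" "3 \<le> n"
  shows "c = classify n R S"
proof (cases c)
  case I_a
  then show ?thesis using assms by (auto simp: classify_def ends_i_def)
next
  case I_b
  then show ?thesis using assms by (auto simp: classify_def ends_i_def)
next
  case I_c
  then show ?thesis using assms by (auto simp: classify_def ends_i_def)
next
  case II_a
  then obtain S' x m y where "ends_ii n R S' x m y" and S: "S = R @ [\<langle>n - 1 \<rightarrow> n + 1; n\<rangle>]"
    using assms(1) by auto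
  from ends_iiD[OF this(1)] show ?thesis
    unfolding classify_def S II_a using assms(2) by auto
next
  case II_b
  then obtain S' x m y where "ends_ii n R S' x m y" and S: "S = butlast R @ [\<langle>y (m - 1) \<rightarrow> n + 1; n\<rangle>]"
    using assms(1) by auto
  from ends_iiD[OF this(1)] show ?thesis
    unfolding classify_def S II_b using assms(2) by auto
next
  case II_c
  then obtain S' x m y where "ends_ii n R S' x m y" and S: "S = S' @ [\<langle>x \<rightarrow> n + 1; y 1\<rangle>]
      @ map (\<lambda>i. \<langle>y i \<rightarrow> y (i + 1); n + 1\<rangle>) [1..<m - 1]
      @ [\<langle>y (m - 1) \<rightarrow> n - 1; n + 1\<rangle>, \<langle>n - 1 \<rightarrow> n; n + 1\<rangle>]"
    using assms(1) by auto
  from ends_iiD[OF this(1)] show ?thesis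
    unfolding classify_def S II_c using assms(2) by auto
next
  case II_d
  then obtain S' x m y where "ends_ii n R S' x m y" and S: "S = S' @ [\<langle>x \<rightarrow> n + 1; y 1\<rangle>]
      @ map (\<lambda>i. \<langle>y i \<rightarrow> y (i + 1); n + 1\<rangle>) [1..<m - 1]
      @ [\<langle>y (m - 1) \<rightarrow> n; n + 1\<rangle>]"
    using assms(1) by auto
  from ends_iiD[OF this(1)] show ?thesis
    unfolding classify_def S II_d using assms(2) by auto
next
  case III_a
  then show ?thesis using assms by (auto simp: classify_def ends_iii_def butlast_append)
next
  case III_b
  then show ?thesis using assms by (auto simp: classify_def ends_iii_def butlast_append)
next
  case III_c
  then show ?thesis using assms by (auto simp: classify_def ends_iii_def butlast_append)
next
  case III_d
  then show ?thesis using assms by (auto simp: classify_def ends_iii_def butlast_append)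
next
  case III_e
  then show ?thesis using assms by (auto simp: classify_def ends_iii_def butlast_append)
qed

section \<open>The final part of the path\<close>

text \<open>\<open>H\<close> consists of the points with both coordinates below \<open>n\<close>; by symmetry the
  step leaving this region may be taken to move the first coordinate.\<close>

locale oriented_walk =
  fixes n :: nat and H T :: "point list"
  assumes n: "3 \<le> n"
    and walk: "walk (n + 1) (H @ T)"
    and coherent: "coherent_steps (enhanced_steps (H @ T))"
    and H_nonempty: "H \<noteq> []"
    and T_nonempty: "T \<noteq> []"
    and H_less: "p \<in> set H \<Longrightarrow> fst p < n \<and> snd p < n"
    and hd_T_ge: "n \<le> fst (hd T)"
begin

definition x where "x = fst (last H)"
definition y where "y = snd (last H)"

lemma last_H: "last H = (x, y)"
  by (simp add: x_def y_def)

lemma xy_less: "x < n" "y < n"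
  using H_less[OF last_in_set[OF H_nonempty]] by (simp_all add: x_def y_def)

lemma moves: "successively lattice_move H" "successively lattice_move T"
    "lattice_move (last H) (hd T)"
  using walk H_nonempty T_nonempty by (auto simp: walk_def successively_append_iff)

lemma points: "p \<in> set (H @ T) \<Longrightarrow> p \<in> {1..n + 1} \<times> {1..n + 1} \<and> fst p \<noteq> snd p"
  using walk unfolding walk_def by blast

lemma xy_pos: "1 \<le> x" "1 \<le> y" "x \<noteq> y"
  using points[of "last H"] last_in_set[OF H_nonempty] by (auto simp: last_H)

lemma hd_T: "hd T = (n, y) \<or> hd T = (n + 1, y)"
proof -
  have "fst (last H) \<noteq> fst (hd T)" using hd_T_ge xy_less by (simp add: last_H)
  then have "snd (hd T) = y" using moves(3) by (auto simp: lattice_move_def last_H)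
  moreover have "fst (hd T) \<le> n + 1" using points[of "hd T"] T_nonempty by auto
  ultimately show ?thesis using hd_T_ge by (cases "hd T") auto
qed

lemma last_T: "last T \<in> {(n, n + 1), (n + 1, n)}"
  using walk T_nonempty by (simp add: walk_def)

lemma hd_H: "hd H \<in> {(2, 1), (1, 2)}"
  using walk H_nonempty by (simp add: walk_def)

lemma steps_eq: "enhanced_steps (H @ T) =
    enhanced_steps H @ \<langle>x \<rightarrow> fst (hd T); y\<rangle> # enhanced_steps T"
proof -
  have "enhanced_step (last H) (hd T) = \<langle>x \<rightarrow> fst (hd T); y\<rangle>"
    using hd_T xy_less by (auto simp: last_H enhanced_step_def)
  then show ?thesis by (simp add: enhanced_steps_append H_nonempty T_nonempty)
qed

lemma compatible_steps:
  "sorted_wrt compatible (enhanced_steps H @ \<langle>x \<rightarrow> fst (hd T); y\<rangle> # enhanced_steps T)"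
  using coherent by (simp only: steps_eq coherent_steps_iff)

lemma fst_T: "p \<in> set T \<Longrightarrow> fst (hd T) \<le> fst p \<and> fst p \<le> n + 1"
  using sorted_wrt_weakly_below[OF moves(2)] points[of p] T_nonempty
  by (cases T) (auto simp: weakly_below_def)

text \<open>In the third form a further step of the second coordinate at height \<open>n + 1\<close> would start
  strictly between \<open>y\<close> and \<open>n\<close>, which is incompatible with the step \<open>\<langle>x \<rightarrow> n; y\<rangle>\<close>.\<close>

lemma tail_forms:
  obtains bs where "bs \<noteq> []" "sorted_wrt (<) bs" "hd bs = y" "last bs < n"
    "T = map (Pair (n + 1)) (bs @ [n]) \<or> T = map (Pair n) (bs @ [n + 1]) \<or>
     bs = [y] \<and> T = [(n, y), (n + 1, y), (n + 1, n)]"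
proof (cases "fst (hd T) = n + 1")
  case True
  then have "\<forall>p\<in>set T. fst p = n + 1" using fst_T by fastforce
  then obtain ys where T: "T = map (Pair (n + 1)) ys" and ys: "sorted_wrt (<) ys"
    using vertical_walk[OF moves(2)] by metis
  have "ys \<noteq> []" using T T_nonempty by simp
  moreover have "last ys = n" using last_T T \<open>ys \<noteq> []\<close> by (auto simp: last_map)
  ultimately have ys_eq: "ys = butlast ys @ [n]" by (metis append_butlast_last_id)
  have "hd ys = y" using hd_T T \<open>ys \<noteq> []\<close> by (auto simp: hd_map)
  then have ne: "butlast ys \<noteq> []"
    using ys_eq xy_less by (metis append_Nil less_irrefl list.sel(1))
  moreover have "sorted_wrt (<) (butlast ys)" "\<forall>a\<in>set (butlast ys). a < n"
    using ys by (subst (asm) ys_eq, simp add: sorted_wrt_append)+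
  moreover have "hd (butlast ys) = y"
    using \<open>hd ys = y\<close> ne ys_eq by (metis hd_append2)
  ultimately show thesis
    using that[of "butlast ys"] T ys_eq by (metis last_in_set)
next
  case False
  then have hdT: "hd T = (n, y)" using hd_T by auto
  \<comment> \<open>The path enters column \<open>n\<close> and may later move on to column
    \<open>n + 1\<close>; the cut is made at that move.\<close>
  define T1 T2 where "T1 = takeWhile (\<lambda>p. fst p = n) T" and "T2 = dropWhile (\<lambda>p. fst p = n) T"
  have T: "T = T1 @ T2" by (simp add: T1_def T2_def)
  have "T1 \<noteq> []" using hdT T_nonempty by (cases T) (auto simp: T1_def)
  have "\<forall>p\<in>set T1. fst p = n" using set_takeWhileD by (fastforce simp: T1_def)
  moreover have "successively lattice_move T1"
    using moves(2) by (simp add: T successively_append_iff)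
  ultimately obtain ys where T1: "T1 = map (Pair n) ys" and ys: "sorted_wrt (<) ys"
    using vertical_walk by metis
  have "ys \<noteq> []" using T1 \<open>T1 \<noteq> []\<close> by simp
  have hd_ys: "hd ys = y" using hdT T T1 \<open>ys \<noteq> []\<close> by (auto simp: hd_map)
  \<comment> \<open>The point \<open>(n, n)\<close> lies on the diagonal, so column \<open>n\<close>
    skips height \<open>n\<close>.\<close>
  have ys_ne: "a \<noteq> n" if "a \<in> set ys" for a
    using points[of "(n, a)"] that by (auto simp: T T1)
  show thesis
  proof (cases "T2 = []")
    case True
    have "last ys = n + 1" using last_T T T1 True \<open>ys \<noteq> []\<close> by (auto simp: last_map)
    then have ys_eq: "ys = butlast ys @ [n + 1]" using \<open>ys \<noteq> []\<close> by (metis append_butlast_last_id)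
    have ne: "butlast ys \<noteq> []"
      using ys_eq xy_less hd_ys by (metis append_Nil less_irrefl list.sel(1) not_add_less1)
    moreover have "sorted_wrt (<) (butlast ys)" "\<forall>a\<in>set (butlast ys). a < n + 1"
      using ys by (subst (asm) ys_eq, simp add: sorted_wrt_append)+
    moreover have "hd (butlast ys) = y"
      using hd_ys ne ys_eq by (metis hd_append2)
    moreover have "last (butlast ys) \<noteq> n"
      by (rule ys_ne[OF in_set_butlastD[OF last_in_set[OF ne]]])
    ultimately show thesis
      using that[of "butlast ys"] T T1 True ys_eq
      by (metis append_Nil2 last_in_set less_Suc_eq Suc_eq_plus1)
  next
    case False
    \<comment> \<open>The first coordinate never decreases and is at most \<open>n + 1\<close>, so
      after leaving column \<open>n\<close> the path stays in column \<open>n + 1\<close>.\<close>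
    have "fst (hd T2) \<noteq> n" using False hd_dropWhile[of "\<lambda>p. fst p = n" T] unfolding T2_def by blast
    moreover have "fst (hd T2) \<ge> n" using fst_T[of "hd T2"] False hdT by (auto simp: T)
    moreover have "successively lattice_move T2"
      using moves(2) by (simp add: T successively_append_iff)
    moreover have "fst (hd T2) \<le> fst p \<and> fst p \<le> n + 1" if "p \<in> set T2" for p
      using sorted_wrt_weakly_below[OF calculation(3)] points[of p] that
      by (cases T2) (auto simp: weakly_below_def T)
    ultimately have "\<forall>p\<in>set T2. fst p = n + 1" by fastforce
    then obtain ws where T2: "T2 = map (Pair (n + 1)) ws" and ws: "sorted_wrt (<) ws"
      using vertical_walk[OF \<open>successively lattice_move T2\<close>] by metis
    have "ws \<noteq> []" using T2 False by simp
    have "last ws = n" using last_T T T2 \<open>ws \<noteq> []\<close> by (auto simp: last_map)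
    then have ws_eq: "ws = butlast ws @ [n]" using \<open>ws \<noteq> []\<close> by (metis append_butlast_last_id)
    have "lattice_move (last T1) (hd T2)"
      using moves(2) \<open>T1 \<noteq> []\<close> False by (simp add: T successively_append_iff)
    then have hd_ws: "hd ws = last ys"
      using T1 T2 \<open>ys \<noteq> []\<close> \<open>ws \<noteq> []\<close> by (auto simp: last_map hd_map lattice_move_def)
    then have ne: "butlast ws \<noteq> []"
      using ws_eq ys_ne \<open>ys \<noteq> []\<close> by (metis append_Nil last_in_set list.sel(1))
    have "s = y" if s: "s \<in> set (butlast ws)" for s
    proof -
      obtain t where "\<langle>s \<rightarrow> t; n + 1\<rangle> \<in> set (climb (n + 1) ws)"
        using src_climb[OF s] ws_eq by metis
      then have "\<langle>s \<rightarrow> t; n + 1\<rangle> \<in> set (enhanced_steps T)"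
        using \<open>T1 \<noteq> []\<close> False by (simp add: T enhanced_steps_append T2 enhanced_steps_map_Pair)
      then have "compatible \<langle>x \<rightarrow> n; y\<rangle> \<langle>s \<rightarrow> t; n + 1\<rangle>"
        using compatible_steps hdT by (simp add: sorted_wrt_append)
      moreover have "s < n"
        using ws s by (subst (asm) ws_eq) (simp add: sorted_wrt_append)
      ultimately show ?thesis by (simp add: compatible_def)
    qed
    \<comment> \<open>All entries equal \<open>y\<close>, so without repetitions there is only
      one.\<close>
    moreover have "distinct (butlast ws)"
      using ws by (simp add: strict_sorted_iff distinct_butlast)
    ultimately have ws': "butlast ws = [y]"
      using ne by (cases "butlast ws" rule: remdups_adj.cases) auto
    then have "last ys = y" using hd_ws ws_eq by (metis append_Cons list.sel(1))
    then have "ys = [y]"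
      using hd_eq_last_imp_singleton[OF ys \<open>ys \<noteq> []\<close>] hd_ys by simp
    moreover have "ws = [y, n]" using ws_eq ws' by simp
    ultimately have "T = [(n, y), (n + 1, y), (n + 1, n)]" by (simp add: T T1 T2)
    then show thesis using that[of "[y]"] xy_less by simp
  qed
qed

section \<open>The sources of the final climb\<close>

text \<open>The final height (\<open>n\<close> or \<open>n + 1\<close>) is split off, so that one
  list of heights below \<open>n\<close> serves all three forms of \<open>T\<close>.\<close>

definition sources :: "nat list \<Rightarrow> bool" where
  "sources bs \<longleftrightarrow> bs \<noteq> [] \<and> sorted_wrt (<) bs \<and> hd bs = y \<and> last bs < n \<and>
    (T = map (Pair (n + 1)) (bs @ [n]) \<or> T = map (Pair n) (bs @ [n + 1]) \<or>
     bs = [y] \<and> T = [(n, y), (n + 1, y), (n + 1, n)])"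

text \<open>The heights of the restriction in column \<open>n\<close>: the same sources, with the
  end point \<open>n - 1\<close> added unless it is already a source.\<close>

definition close :: "nat list \<Rightarrow> nat list" where
  "close bs = (if last bs = n - 1 then bs else bs @ [n - 1])"

lemma ex_sources: "\<exists>bs. sources bs"
  using tail_forms unfolding sources_def by metis

lemma sources_bounds:
  assumes "sources bs" "a \<in> set bs"
  shows "y \<le> a" "a \<le> last bs" "a < n"
proof -
  from assms(1) have bs: "bs \<noteq> []" "sorted_wrt (<) bs" "hd bs = y" "last bs < n"
    by (auto simp: sources_def)
  show "y \<le> a" using bs assms(2) by (cases bs) auto
  show "a \<le> last bs" by (rule le_last[OF bs(2) assms(2)])
  then show "a < n" using bs(4) by simp
qed

text \<open>The inclusion for \<open>butlast\<close> says that every source of the restricted climb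
  is a source of the original one; coherence is transferred along it.\<close>

lemma close_props:
  assumes "sources bs"
  shows "close bs \<noteq> []" "sorted_wrt (<) (close bs)" "hd (close bs) = y"
    "last (close bs) = n - 1" "set (butlast (close bs)) \<subseteq> set bs"
    "\<And>a. a \<in> set (close bs) \<Longrightarrow> y \<le> a \<and> a \<le> n - 1"
proof -
  from assms have bs: "bs \<noteq> []" "sorted_wrt (<) bs" "hd bs = y" "last bs < n"
    by (auto simp: sources_def)
  have less: "a < n - 1" if "a \<in> set bs" "last bs \<noteq> n - 1" for a
    using sources_bounds(2)[OF assms that(1)] that(2) bs(4) by simp
  show "close bs \<noteq> []" "hd (close bs) = y" "last (close bs) = n - 1"
    using bs by (auto simp: close_def)
  show "set (butlast (close bs)) \<subseteq> set bs"
    by (auto simp: close_def dest: in_set_butlastD)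
  show "sorted_wrt (<) (close bs)"
    using bs less by (simp add: close_def sorted_wrt_append)
  show "y \<le> a \<and> a \<le> n - 1" if "a \<in> set (close bs)" for a
  proof -
    have "a \<in> set bs \<or> a = n - 1"
      using that by (auto simp: close_def split: if_splits)
    moreover have "y \<le> n - 1" using xy_less by simp
    ultimately show ?thesis
      using sources_bounds(1,3)[OF assms] by fastforce
  qed
qed

section \<open>The restriction\<close>

abbreviation R where "R \<equiv> restriction n (H @ T)"

lemma moves_append:
  assumes "ys \<noteq> []" "sorted_wrt (<) ys" "hd ys = y"
  shows "successively lattice_move (H @ map (Pair n) ys)"
proof -
  have "successively lattice_move (map (Pair n) ys)"
    unfolding successively_map using successively_if_sorted_wrt[OF assms(2)]
    by (rule successively_mono) (simp add: lattice_move_def)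
  moreover have "lattice_move (x, y) (n, y)"
    using xy_less by (simp add: lattice_move_def)
  ultimately show ?thesis
    using moves(1) assms by (simp add: successively_append_iff last_H hd_map)
qed

text \<open>Replacing \<open>n + 1\<close> by \<open>n\<close> folds both columns into column
  \<open>n\<close>, so the three forms of \<open>T\<close> yield the same heights \<open>bs\<close>,
  followed by \<open>(n, n)\<close>, which is adjusted to \<open>(n, n - 1)\<close>.\<close>

lemma restriction_eq:
  assumes "sources bs"
  shows "R = H @ map (Pair n) (close bs)"
proof -
  let ?r = "map_prod (replace_coord n) (replace_coord n)"
  from assms have bs: "bs \<noteq> []" "sorted_wrt (<) bs" "hd bs = y" "last bs < n"
    and T: "T = map (Pair (n + 1)) (bs @ [n]) \<or> T = map (Pair n) (bs @ [n + 1]) \<or>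
      bs = [y] \<and> T = [(n, y), (n + 1, y), (n + 1, n)]"
    by (auto simp: sources_def)
  have H: "map ?r H = H"
    using H_less by (intro map_idI) (fastforce simp: replace_coord_def)
  have bs_map: "map (?r \<circ> Pair c) bs = map (Pair n) bs" if "c = n \<or> c = n + 1" for c
  proof (rule map_cong[OF refl])
    fix a assume "a \<in> set bs"
    then have "a < n" by (rule sources_bounds(3)[OF assms])
    with that show "(?r \<circ> Pair c) a = (n, a)" by (auto simp: replace_coord_def)
  qed
  \<comment> \<open>The last height in \<open>bs\<close> is below \<open>n\<close>, so the first
    test fails and the second succeeds.\<close>
  have last: "adjust_last n (last (H @ map (Pair n) bs)) q = (n, n - 1)" for q
    using bs by (simp add: last_map adjust_last_def)
  have no_dups: "remdups_adj (H @ map (Pair n) bs) = H @ map (Pair n) bs"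
    by (rule remdups_adj_walk[OF moves_append[OF bs(1-3)]])
  have "R = remdups_adj ((H @ map (Pair n) bs) @ [(n, n - 1)])"
    using T
  proof (elim disjE conjE)
    assume T: "T = map (Pair (n + 1)) (bs @ [n])"
    have "map ?r (H @ T) = (H @ map (Pair n) bs) @ [(n, n)]"
      using bs_map[of "n + 1"] by (simp add: H T replace_coord_def)
    then show ?thesis
      unfolding restriction_def Let_def by (simp only: butlast_snoc last)
  next
    assume T: "T = map (Pair n) (bs @ [n + 1])"
    have "map ?r (H @ T) = (H @ map (Pair n) bs) @ [(n, n)]"
      using bs_map[of n] by (simp add: H T replace_coord_def)
    then show ?thesis
      unfolding restriction_def Let_def by (simp only: butlast_snoc last)
  next
    assume T: "bs = [y]" "T = [(n, y), (n + 1, y), (n + 1, n)]"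
    \<comment> \<open>The points \<open>(n, y)\<close> and \<open>(n + 1, y)\<close> fall together,
      a repetition that the other two forms lack.\<close>
    have "map ?r (H @ T) = (H @ [(n, y), (n, y)]) @ [(n, n)]"
      using xy_less by (simp add: H T replace_coord_def)
    then have "R = remdups_adj ((H @ [(n, y), (n, y)]) @ [adjust_last n (n, y) (n, n)])"
      unfolding restriction_def Let_def by (simp only: butlast_snoc) simp
    also have "adjust_last n (n, y) (n, n) = (n, n - 1)"
      using xy_less by (simp add: adjust_last_def)
    finally show ?thesis
      using remdups_adj_append[of "H @ [(n, y)]" "(n, y)" "[(n, n - 1)]"]
        remdups_adj_append[of H "(n, y)" "[(n, n - 1)]"]
        remdups_adj_append_two[of H "(n, y)" "(n, y)"]
      by (simp add: T)
  qed
  \<comment> \<open>The only repetition left to discard is at the end, when the climb has already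
    reached \<open>n - 1\<close>.\<close>
  also have "\<dots> = (H @ map (Pair n) bs) @ (if last bs = n - 1 then [] else [(n, n - 1)])"
  proof -
    have eq: "H @ map (Pair n) bs = (H @ map (Pair n) (butlast bs)) @ [(n, last bs)]"
      using arg_cong[OF append_butlast_last_id[OF bs(1)], of "map (Pair n)"] by simp
    have "remdups_adj ((H @ map (Pair n) bs) @ [(n, n - 1)]) =
        remdups_adj (H @ map (Pair n) bs) @ (if (n, last bs) = (n, n - 1) then [] else [(n, n - 1)])"
      unfolding eq append_assoc append_Cons append_Nil
      by (subst (2) append_assoc[symmetric], subst append_assoc[symmetric],
          rule remdups_adj_append_two)
    then show ?thesis by (simp add: no_dups)
  qed
  finally show ?thesis by (simp add: close_def)
qed

lemma hd_restriction: "hd R = hd (H @ T)"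
  using restriction_eq ex_sources H_nonempty by (metis hd_append2)

lemma walk_restriction: "walk n R"
proof -
  obtain bs where bs: "sources bs" using ex_sources by blast
  note zs = close_props[OF bs]
  have H: "p \<in> {1..n} \<times> {1..n}" "fst p \<noteq> snd p" if "p \<in> set H" for p
    using H_less[OF that] points[of p] that by (simp_all add: mem_Times_iff)
  moreover have "p \<in> {1..n} \<times> {1..n}" "fst p \<noteq> snd p" if p: "p \<in> set (map (Pair n) (close bs))" for p
  proof -
    obtain a where "a \<in> set (close bs)" "p = (n, a)" using p by auto
    moreover from this have "y \<le> a" "a \<le> n - 1" using zs(6) by auto
    moreover have "n - 1 < n" using n by simp
    ultimately show "p \<in> {1..n} \<times> {1..n}" "fst p \<noteq> snd p"
      using xy_pos by auto
  qed
  ultimately have "set R \<subseteq> {1..n} \<times> {1..n}" "\<forall>p\<in>set R. fst p \<noteq> snd p"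
    unfolding restriction_eq[OF bs] set_append by blast+
  moreover have "hd R = hd H" "last R = (n, n - 1)" "R \<noteq> []"
    unfolding restriction_eq[OF bs] using H_nonempty zs(1,4) by (simp_all add: last_map)
  moreover have "successively lattice_move R"
    unfolding restriction_eq[OF bs] by (rule moves_append[OF zs(1-3)])
  ultimately show ?thesis
    unfolding walk_def using hd_H by simp
qed

section \<open>Coherence of the restriction\<close>

lemma steps_restriction:
  assumes "sources bs"
  shows "enhanced_steps R = enhanced_steps H @ \<langle>x \<rightarrow> n; y\<rangle> # climb n (close bs)"
  using H_nonempty close_props[OF assms] xy_less unfolding restriction_eq[OF assms]
  by (simp add: enhanced_steps_append enhanced_steps_map_Pair hd_map last_H enhanced_step_def)

text \<open>The bound \<open>n \<le> c\<close> puts the fixed coordinate above every target inside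
  \<open>H\<close>, which excludes one alternative of compatibility.\<close>

lemma later_step:
  assumes "sources bs" "s \<in> set bs"
  shows "\<exists>t c. n \<le> c \<and> \<langle>s \<rightarrow> t; c\<rangle> \<in> set (enhanced_steps T)"
proof -
  from assms(1) have T: "T = map (Pair (n + 1)) (bs @ [n]) \<or> T = map (Pair n) (bs @ [n + 1]) \<or>
      bs = [y] \<and> T = [(n, y), (n + 1, y), (n + 1, n)]"
    by (auto simp: sources_def)
  then show ?thesis
  proof (elim disjE conjE)
    assume "T = map (Pair (n + 1)) (bs @ [n])"
    then show ?thesis
      using src_climb[OF assms(2)] by (metis enhanced_steps_map_Pair le_add1)
  next
    assume "T = map (Pair n) (bs @ [n + 1])"
    then show ?thesis
      using src_climb[OF assms(2)] by (metis enhanced_steps_map_Pair order_refl)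
  next
    assume "bs = [y]" "T = [(n, y), (n + 1, y), (n + 1, n)]"
    then have "\<langle>s \<rightarrow> n; n + 1\<rangle> \<in> set (enhanced_steps T)"
      using assms(2) by (simp add: enhanced_step_def)
    then show ?thesis by (metis le_add1)
  qed
qed

lemma tgt_less:
  assumes "s \<in> set (enhanced_steps H)"
  shows "tgt s < n"
proof -
  have "\<exists>p\<in>set L. tgt s = fst p \<or> tgt s = snd p" if "s \<in> set (enhanced_steps L)" for L
    using that by (induction L rule: induct_list012) (auto simp: enhanced_step_def)
  then show ?thesis using assms H_less by fastforce
qed

text \<open>The target of \<open>s\<close> is below \<open>n\<close> while the step starting at
  \<open>b\<close> has fixed coordinate at least \<open>n\<close>; these cannot agree, so
  compatibility leaves only the alternative on the source.\<close>

lemma source_eq_other: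
  assumes "sources bs" "b \<in> set bs" "s \<in> set (enhanced_steps H)" "b < tgt s"
  shows "b = other s"
proof -
  obtain t c where "n \<le> c" "\<langle>b \<rightarrow> t; c\<rangle> \<in> set (enhanced_steps T)"
    using later_step[OF assms(1,2)] by blast
  then have "compatible s \<langle>b \<rightarrow> t; c\<rangle>"
    using compatible_steps assms(3) by (auto simp: sorted_wrt_append)
  then show ?thesis
    using assms(4) tgt_less[OF assms(3)] \<open>n \<le> c\<close> by (simp add: compatible_def)
qed

text \<open>Changing the targets of the later steps does not affect compatibility with the steps
  inside \<open>H\<close>, and neither does replacing \<open>n + 1\<close> by \<open>n\<close> in the coordinate that stays fixed, since both exceed
  every target inside \<open>H\<close>.\<close>

lemma coherent_restriction: "coherent_steps (enhanced_steps R)"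
proof -
  obtain bs where bs: "sources bs" using ex_sources by blast
  note zs = close_props[OF bs]
  have "compatible s \<langle>x \<rightarrow> n; y\<rangle>" if "s \<in> set (enhanced_steps H)" for s
    using compatible_steps that by (auto simp: sorted_wrt_append compatible_def)
  moreover have "compatible s t"
    if s: "s \<in> set (enhanced_steps H)" and t: "t \<in> set (climb n (close bs))" for s t
    using source_eq_other[OF bs _ s] in_climbD[OF t] zs(5) by (auto simp: compatible_def)
  \<comment> \<open>Target \<open>n\<close> of the entering step equals the fixed coordinate of
    every climb step.\<close>
  moreover have "compatible \<langle>x \<rightarrow> n; y\<rangle> t" if "t \<in> set (climb n (close bs))" for t
    using in_climbD[OF that] by (simp add: compatible_def)
  moreover have "sorted_wrt compatible (enhanced_steps H)"
    using compatible_steps by (simp add: sorted_wrt_append)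
  ultimately show ?thesis
    using coherent_climb[OF zs(2)]
    by (auto simp: coherent_steps_iff steps_restriction[OF bs] sorted_wrt_append)
qed

text \<open>If \<open>x = n - 1\<close>, some step inside \<open>H\<close> ends at \<open>n - 1\<close>, and its fixed coordinate equals every
  later source below \<open>n - 1\<close>; so there is at most one such source.\<close>

lemma x_less:
  assumes bs: "sources bs" and len: "3 \<le> length (close bs)"
  shows "x < n - 1"
proof (rule ccontr)
  assume "\<not> x < n - 1"
  then have x: "x = n - 1" using xy_less by simp
  note zs = close_props[OF bs]
  obtain a b c zs' where zs_eq: "close bs = a # b # c # zs'"
    using len by (auto simp: numeral_3_eq_3 Suc_le_length_iff)
  \<comment> \<open>The third height \<open>c\<close> may be the added \<open>n - 1\<close>; the
    first two are genuine sources.\<close>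
  have ab: "a \<in> set bs" "b \<in> set bs" using zs(5) by (auto simp: zs_eq)
  have less: "a < b" "b < c" "c \<le> n - 1" "1 \<le> a"
    using zs(2) zs(6)[of c] zs(3) xy_pos by (auto simp: zs_eq)
  \<comment> \<open>Three increasing positive heights force \<open>3 \<le> n - 1\<close>, above both
    coordinates of the start.\<close>
  then have "fst (hd H) < fst (last H)"
    using hd_H x by (auto simp: last_H)
  from ex_step_into[OF moves(1) H_nonempty this]
  obtain u w where step: "\<langle>u \<rightarrow> n - 1; w\<rangle> \<in> set (enhanced_steps H)"
    by (auto simp: last_H x)
  have "a = w" "b = w"
    using source_eq_other[OF bs ab(1) step] source_eq_other[OF bs ab(2) step] less by auto
  then show False using less by simp
qed

text \<open>Lengths 1, 2 and at least 3 of \<open>zs\<close> give (i), (iii) and (ii). The form of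
  \<open>S\<close>, and whether \<open>bs\<close> contains \<open>n - 1\<close>, give the
  subcase.\<close>

lemma ex_restriction_case:
  "\<exists>c. restriction_case c n (enhanced_steps R) (enhanced_steps (H @ T))"
proof -
  obtain bs where bs: "sources bs" using ex_sources by blast
  define zs where "zs = close bs"
  note zs = close_props[OF bs, folded zs_def]
  define A where "A = enhanced_steps H"
  define S where "S = enhanced_steps (H @ T)"
  have R: "enhanced_steps R = A @ \<langle>x \<rightarrow> n; y\<rangle> # climb n zs"
    by (simp add: steps_restriction[OF bs] A_def zs_def)
  from bs have bs': "bs \<noteq> []" "hd bs = y"
    and T: "T = map (Pair (n + 1)) (bs @ [n]) \<or> T = map (Pair n) (bs @ [n + 1]) \<or>
      bs = [y] \<and> T = [(n, y), (n + 1, y), (n + 1, n)]"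
    by (auto simp: sources_def)
  have "hd (bs @ [a]) = y" for a using bs' by simp
  then have S: "S = A @ \<langle>x \<rightarrow> n + 1; y\<rangle> # climb (n + 1) (bs @ [n]) \<or>
      S = A @ \<langle>x \<rightarrow> n; y\<rangle> # climb n (bs @ [n + 1]) \<or>
      bs = [y] \<and> S = A @ [\<langle>x \<rightarrow> n; y\<rangle>, \<langle>n \<rightarrow> n + 1; y\<rangle>, \<langle>y \<rightarrow> n; n + 1\<rangle>]"
    using T unfolding S_def steps_eq A_def
    \<comment> \<open>The deleted rules would break up \<open>map (Pair c) (bs @ [a])\<close> before
      \<open>enhanced_steps_map_Pair\<close> can apply.\<close>
    by (auto simp: enhanced_steps_map_Pair hd_map enhanced_step_def
        simp del: map_append list.map)
  have bs_zs: "bs = zs \<and> last bs = n - 1 \<or> zs = bs @ [n - 1] \<and> last bs \<noteq> n - 1"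
    by (auto simp: zs_def close_def)
  consider "length zs = 1" | "length zs = 2" | "3 \<le> length zs"
    using zs(1) by (cases "length zs") (auto, linarith)
  then have "\<exists>c. restriction_case c n (enhanced_steps R) S"
  proof cases
    case 1
    then have "zs = [n - 1]" using zs(1,4) by (cases zs) auto
    \<comment> \<open>Appending \<open>n - 1\<close> to the nonempty \<open>bs\<close> would give
      two heights, so \<open>bs\<close> is \<open>zs\<close> itself. Then \<open>y = n - 1\<close>,
      and \<open>x < n - 1\<close> follows from \<open>x \<noteq> y\<close>.\<close>
    then have *: "bs = [n - 1]" "zs = [n - 1]" "y = n - 1"
      using bs_zs bs' zs(3) by auto
    then have ends: "ends_i n (enhanced_steps R) A x"
      using R xy_pos xy_less by (simp add: ends_i_def)
    from S show ?thesis
    proof (elim disjE conjE)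
      assume "S = A @ \<langle>x \<rightarrow> n + 1; y\<rangle> # climb (n + 1) (bs @ [n])"
      then have "restriction_case I_c n (enhanced_steps R) S" using ends * by auto
      then show ?thesis ..
    next
      assume "S = A @ \<langle>x \<rightarrow> n; y\<rangle> # climb n (bs @ [n + 1])"
      then have "restriction_case I_a n (enhanced_steps R) S" using ends * R by auto
      then show ?thesis ..
    next
      assume "S = A @ [\<langle>x \<rightarrow> n; y\<rangle>, \<langle>n \<rightarrow> n + 1; y\<rangle>, \<langle>y \<rightarrow> n; n + 1\<rangle>]"
      then have "restriction_case I_b n (enhanced_steps R) S" using ends * R by auto
      then show ?thesis ..
    qed
  next
    case 2
    then have zs_eq: "zs = [y, n - 1]"
      using zs(3,4) by (auto simp: numeral_2_eq_2 length_Suc_conv)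
    then have "y < n - 1" using zs(2) by simp
    then have ends: "ends_iii n (enhanced_steps R) A x y"
      using R zs_eq xy_less by (simp add: ends_iii_def)
    have bs_eq: "bs = [y, n - 1] \<or> bs = [y]"
      using bs_zs zs_eq by auto
    from S show ?thesis
    proof (elim disjE conjE)
      assume S: "S = A @ \<langle>x \<rightarrow> n + 1; y\<rangle> # climb (n + 1) (bs @ [n])"
      from bs_eq have "restriction_case III_d n (enhanced_steps R) S \<or>
          restriction_case III_e n (enhanced_steps R) S"
        using ends S by auto
      then show ?thesis by blast
    next
      assume S: "S = A @ \<langle>x \<rightarrow> n; y\<rangle> # climb n (bs @ [n + 1])"
      from bs_eq have "restriction_case III_a n (enhanced_steps R) S \<or>
          restriction_case III_b n (enhanced_steps R) S"
        using ends S R zs_eq by (auto simp: butlast_append)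
      then show ?thesis by blast
    next
      assume "S = A @ [\<langle>x \<rightarrow> n; y\<rangle>, \<langle>n \<rightarrow> n + 1; y\<rangle>, \<langle>y \<rightarrow> n; n + 1\<rangle>]"
      then have "restriction_case III_c n (enhanced_steps R) S"
        using ends R zs_eq by (auto simp: butlast_append)
      then show ?thesis ..
    qed
  next
    case 3
    define m where "m = length zs"
    \<comment> \<open>Shifts to one-based indices: \<open>f 1\<close> is \<open>y\<close> and
      \<open>f m\<close> is \<open>n - 1\<close>.\<close>
    define f where "f i = zs ! (i - 1)" for i
    define us where "us = butlast zs"
    have m: "3 \<le> m" "length us = m - 1" "us \<noteq> []"
      using 3 by (auto simp: m_def us_def simp flip: length_0_conv)
    have zs_eq: "zs = us @ [n - 1]" using zs(1,4) by (metis us_def append_butlast_last_id)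
    have "m - 1 - 1 < length us" using m by linarith
    then have last_us: "last us = f (m - 1)"
      using last_conv_nth[OF m(3)] m(2) by (simp only: f_def zs_eq nth_append if_True)
    have f1: "f 1 = y" using zs(1,3) by (simp add: f_def hd_conv_nth)
    have climb_zs: "climb n zs = map (\<lambda>i. \<langle>f i \<rightarrow> f (i + 1); n\<rangle>) [1..<m]"
      by (simp add: climb_conv_nth f_def m_def)
    have climb_us: "climb (n + 1) us = map (\<lambda>i. \<langle>f i \<rightarrow> f (i + 1); n + 1\<rangle>) [1..<m - 1]"
      using m by (auto simp: climb_conv_nth f_def zs_eq nth_append)
    have "f i < f (i + 1)" if "i \<in> {1..<m}" for i
      using sorted_wrt_nth_less[OF zs(2)] that by (simp add: f_def m_def)
    moreover have "f m = n - 1"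
      using zs(1,4) by (simp add: f_def m_def last_conv_nth)
    ultimately have ends: "ends_ii n (enhanced_steps R) A x m f"
      using R x_less[OF bs] 3 climb_zs f1 m by (simp add: ends_ii_def zs_def)
    have bs_eq: "bs = us @ [n - 1] \<or> bs = us"
      using bs_zs zs_eq by auto
    from S show ?thesis
    proof (elim disjE conjE)
      assume S: "S = A @ \<langle>x \<rightarrow> n + 1; y\<rangle> # climb (n + 1) (bs @ [n])"
      from bs_eq show ?thesis
      proof
        assume "bs = us @ [n - 1]"
        then have "climb (n + 1) (bs @ [n]) = climb (n + 1) us @
            [\<langle>f (m - 1) \<rightarrow> n - 1; n + 1\<rangle>, \<langle>n - 1 \<rightarrow> n; n + 1\<rangle>]"
          using climb_snoc[of bs "n + 1" n] climb_snoc[OF m(3)] last_us by simp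
        then have "S = A @ [\<langle>x \<rightarrow> n + 1; f 1\<rangle>]
            @ map (\<lambda>i. \<langle>f i \<rightarrow> f (i + 1); n + 1\<rangle>) [1..<m - 1]
            @ [\<langle>f (m - 1) \<rightarrow> n - 1; n + 1\<rangle>, \<langle>n - 1 \<rightarrow> n; n + 1\<rangle>]"
          by (simp only: S climb_us f1 append_Cons append_Nil)
        with ends have "restriction_case II_c n (enhanced_steps R) S"
          unfolding restriction_case.simps
          by (intro exI conjI)
        then show ?thesis ..
      next
        assume "bs = us"
        then have "climb (n + 1) (bs @ [n]) = climb (n + 1) us @ [\<langle>f (m - 1) \<rightarrow> n; n + 1\<rangle>]"
          using climb_snoc[OF m(3)] last_us by simp
        then have "S = A @ [\<langle>x \<rightarrow> n + 1; f 1\<rangle>]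
            @ map (\<lambda>i. \<langle>f i \<rightarrow> f (i + 1); n + 1\<rangle>) [1..<m - 1]
            @ [\<langle>f (m - 1) \<rightarrow> n; n + 1\<rangle>]"
          by (simp only: S climb_us f1 append_Cons append_Nil)
        with ends have "restriction_case II_d n (enhanced_steps R) S"
          unfolding restriction_case.simps
          by (intro exI conjI)
        then show ?thesis ..
      qed
    next
      assume S: "S = A @ \<langle>x \<rightarrow> n; y\<rangle> # climb n (bs @ [n + 1])"
      from bs_eq show ?thesis
      proof
        assume "bs = us @ [n - 1]"
        then have "S = enhanced_steps R @ [\<langle>n - 1 \<rightarrow> n + 1; n\<rangle>]"
          using climb_snoc[of bs n "n + 1"] S R zs_eq by simp
        then have "restriction_case II_a n (enhanced_steps R) S"
          using ends by auto
        then show ?thesis ..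
      next
        assume "bs = us"
        then have "S = butlast (enhanced_steps R) @ [\<langle>f (m - 1) \<rightarrow> n + 1; n\<rangle>]"
          using climb_snoc[OF m(3)] last_us S R zs_eq by (simp add: butlast_append)
        then have "restriction_case II_b n (enhanced_steps R) S"
          using ends by auto
        then show ?thesis ..
      qed
    next
      \<comment> \<open>The third form has a single source, but here \<open>bs\<close> has at least
        two.\<close>
      assume "bs = [y]"
      then show ?thesis using bs_eq m by (cases us) auto
    qed
  qed
  then show ?thesis by (simp only: S_def)
qed

end

section \<open>Exchanging the coordinates\<close>

text \<open>\<open>adjust_last\<close> tests the coordinates in a fixed order. The order is harmless
  since the penultimate point is off the diagonal and one move from the end, so after replacement
  exactly one of its coordinates is \<open>n\<close>.\<close>

lemma restriction_swap:
  assumes "walk (n + 1) L" "3 \<le> n"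
  shows "restriction n (map prod.swap L) = map prod.swap (restriction n L)"
proof -
  let ?r = "map_prod (replace_coord n) (replace_coord n)"
  have "butlast L \<noteq> []"
    using assms by (cases L rule: remdups_adj.cases) (auto simp: walk_def)
  then obtain Q p q where L: "L = Q @ [p, q]"
    by (metis append.assoc append_Cons append_Nil append_butlast_last_id butlast.simps(1))
  have "lattice_move p q" "fst p \<noteq> snd p" "q \<in> {(n, n + 1), (n + 1, n)}"
    using assms(1) by (auto simp: walk_def L successively_append_iff)
  then have "adjust_last n (?r (prod.swap p)) (?r (prod.swap q)) =
      prod.swap (adjust_last n (?r p) (?r q))"
    by (auto simp: adjust_last_def replace_coord_def lattice_move_def split: if_splits)
  moreover have "restriction n (Q' @ [p', q']) =
      remdups_adj (map ?r Q' @ [?r p', adjust_last n (?r p') (?r q')])" for Q' p' q'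
    by (simp add: restriction_def Let_def butlast_append)
  moreover have "?r (prod.swap p) = prod.swap (?r p)"
    by (cases p) simp
  moreover have "map ?r (map prod.swap Q) = map prod.swap (map ?r Q)"
    by (auto simp: map_prod_def split_beta)
  ultimately have "restriction n (map prod.swap L) =
      remdups_adj (map prod.swap (map ?r Q @ [?r p, adjust_last n (?r p) (?r q)]))"
    by (simp add: L del: map_map)
  also have "\<dots> = map prod.swap (remdups_adj (map ?r Q @ [?r p, adjust_last n (?r p) (?r q)]))"
    by (rule remdups_adj_map_injective) simp
  also have "remdups_adj (map ?r Q @ [?r p, adjust_last n (?r p) (?r q)]) = restriction n L"
    by (simp add: L restriction_def Let_def butlast_append)
  finally show ?thesis .
qed

text \<open>\<open>H\<close> is the longest initial part with both coordinates below
  \<open>n\<close>; it contains the start because \<open>3 \<le> n\<close>. If the next point has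
  first coordinate below \<open>n\<close>, its second is at least \<open>n\<close>, and the mirror
  image is oriented.\<close>

lemma ex_oriented_walk:
  assumes "walk (n + 1) L" "coherent_steps (enhanced_steps L)" "3 \<le> n"
  shows "\<exists>H T. oriented_walk n H T \<and> (H @ T = L \<or> H @ T = map prod.swap L)"
proof -
  let ?P = "\<lambda>p. fst p < n \<and> snd p < n"
  define H T where "H = takeWhile ?P L" and "T = dropWhile ?P L"
  have L: "L = H @ T" by (simp add: H_def T_def)
  have "L \<noteq> []" and "?P (hd L)" and "\<not> ?P (last L)"
    using assms by (auto simp: walk_def)
  then have H: "H \<noteq> []" and T: "T \<noteq> []"
    by (auto simp: H_def T_def takeWhile_eq_Nil_iff dropWhile_eq_Nil_conv)
  have H_less: "?P p" if "p \<in> set H" for p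
    using that set_takeWhileD unfolding H_def by fastforce
  have hd_T: "\<not> ?P (hd T)"
    using T hd_dropWhile unfolding T_def by blast
  show ?thesis
  proof (cases "n \<le> fst (hd T)")
    case True
    then have "oriented_walk n H T"
      using assms H T H_less by unfold_locales (simp_all add: L)
    then show ?thesis using L by blast
  next
    case False
    have "coherent_steps (enhanced_steps (map prod.swap L))"
      using assms by (simp add: enhanced_steps_swap walk_def)
    moreover have "n \<le> fst (hd (map prod.swap T))"
      using T hd_T False by (simp add: hd_map)
    ultimately have "oriented_walk n (map prod.swap H) (map prod.swap T)"
      using walk_swap[OF assms(1)] assms(3) H T
      by unfold_locales (auto simp: L dest: H_less)
    then show ?thesis using L by (metis map_append)
  qed
qed

section \<open>Transfer back to the given path\<close>

theorem theorem4p7: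
  fixes n :: nat and L :: "(nat \<times> nat) list"
  assumes "3 \<le> n"
    and "coherent_lattice_path (n + 1) L"
  shows "coherent_lattice_path n (restriction n L)
    \<and> (\<exists>!c. restriction_case c n (enhanced_steps (restriction n L)) (enhanced_steps L))"
proof -
  have L: "walk (n + 1) L" "hd L = (2, 1)" "coherent_steps (enhanced_steps L)"
    using assms(2) by (auto simp: coherent_lattice_path_def diagonal_avoiding_path_iff)
  from ex_oriented_walk[OF L(1,3) assms(1)]
  obtain H T where HT: "oriented_walk n H T" and HT_eq: "H @ T = L \<or> H @ T = map prod.swap L"
    by blast
  interpret oriented_walk n H T by (fact HT)
  let ?R = "restriction n L"
  \<comment> \<open>The case relation sees only enhanced steps, which the exchange preserves;
    \<open>hd\<close> restores the start \<open>(2, 1)\<close>, which \<open>walk\<close> leaves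
    open.\<close>
  have "walk n ?R \<and> hd ?R = hd L \<and> enhanced_steps ?R = enhanced_steps R \<and>
      enhanced_steps L = enhanced_steps (H @ T)"
    using HT_eq
  proof
    assume "H @ T = L"
    then show ?thesis using walk_restriction hd_restriction by simp
  next
    assume eq: "H @ T = map prod.swap L"
    have R_eq: "R = map prod.swap ?R"
      unfolding eq by (rule restriction_swap[OF L(1) assms(1)])
    then have R_eq': "?R = map prod.swap R" by (simp add: map_idI)
    have "walk n ?R" using walk_swap[OF walk_restriction] R_eq' by simp
    moreover have "hd ?R = hd L"
    proof -
      have "prod.swap (hd ?R) = prod.swap (hd L)"
        using hd_restriction R_eq eq \<open>walk n ?R\<close> L(1) by (simp add: hd_map walk_def)
      then show ?thesis by (metis swap_swap)
    qed
    moreover have "enhanced_steps R = enhanced_steps ?R"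
      unfolding R_eq using \<open>walk n ?R\<close> by (intro enhanced_steps_swap) (simp add: walk_def)
    moreover have "enhanced_steps (H @ T) = enhanced_steps L"
      unfolding eq using L(1) by (intro enhanced_steps_swap) (simp add: walk_def)
    ultimately show ?thesis by simp
  qed
  moreover have "\<exists>!c. restriction_case c n (enhanced_steps R) (enhanced_steps (H @ T))"
    using ex_restriction_case restriction_case_classify[OF _ assms(1)] by metis
  ultimately show ?thesis
    using coherent_restriction L(2)
    by (simp add: coherent_lattice_path_def diagonal_avoiding_path_iff)
qed

end
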